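(* Let $X,A$ be finite nonempty sets, $\pi_0$ a probability distribution on $X$, and for $k=1,\dots,K$ let $p_k:X\to\Delta(A)$ be an action selection policy and $U_k:X\times A\to\mathbb{R}$ a utility function; let $\mathcal{D}_{RRI}=\{\pi_0,\{p_k,U_k\}_{k=1}^K\}$. Then the following statements are equivalent. 1) There exists a non-negative information acquisition cost $C$, monotone with respect to the Blackwell order, that rationalizes $\mathcal{D}_{RRI}$ (in the generalized sense defined in the context, with unknown multipliers $\lambda_k>0$). 2) $\mathcal{D}_{RRI}$ satisfies the data-matching condition, NIAS, and the Generalized Axiom of Revealed Rational Inattention (GARRI): for all $k\neq j$, $$p_k\ge_H p_j\ \Longrightarrow\ G(p_k,U_j)\le G(p_j,U_j),$$ where $p_k\ge_H p_j$ means that there exist indices $i_1,\dots,i_L$ with $G(p_{i_1},U_k)\ge G(p_k,U_k)$, $G(p_{i_2},U_{i_1})\ge G(p_{i_1},U_{i_1})$, $\dots$, $G(p_j,U_{i_L})\ge G(p_{i_L},U_{i_L})$. (GARRI is the GARP condition "$\beta_k\ge_H\beta_j\Rightarrow u_j(\beta_k)\le u_j(\beta_j)$" under the substitution $\beta_k\mapsto p_k$, $u_k(\cdot)\mapsto G(\cdot,U_k)$.) 3) $\mathcal{D}_{RRI}$ satisfies the data-matching condition and NIAS, and there exist scalars $\lambda_k>0$, $c_k>0$, $k=1,\dots,K$, such that for all $k\neq j$ $$\lambda_k\sum_{x\in X,a\in A}p_k(a|x)\pi_0(x)U_k(x,a)-c_k\ \ge\ \lambda_k\sum_{a\in A}p_j(a)\Big(\max_{b\in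 A}\sum_{x\in X}p_j(x|a)U_k(x,b)\Big)-c_j .$$ Moreover: 4) If NIAS and GARRI hold, then for any $c_k>0,\lambda_k>0$ satisfying the inequalities in 3), the reconstructed cost, defined on action selection policies $p:X\to\Delta(A)$ by $$\hat C(p)=\max_{k\in\{1,\dots,K\}}\big\{c_k+\lambda_k\big(G(p,U_k)-G(p_k,U_k)\big)\big\},$$ rationalizes $\mathcal{D}_{RRI}$ (with signal set $Y=A$, attention strategies $\alpha_k=p_k$, and multipliers $\lambda_k$). The cost $\hat C$ is a pointwise maximum of functions of $p$ that are convex and monotone with respect to the Blackwell order on action selection policies, and it satisfies weak monotonicity ($\hat C(\hat p)\le\hat C(p)$ whenever $p$ Blackwell dominates $\hat p$) and mixture feasibility ($\hat C(\theta p'+(1-\theta)p'')\le\theta\hat C(p')+(1-\theta)\hat C(p'')$ for all policies $p',p''$ and $\theta\in[0,1]$).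
   Context: $\Delta(S)$ is the set of probability distributions on a finite set $S$. For a policy $p:X\to\Delta(A)$ write $p(a)=\sum_x\pi_0(x)p(a|x)$ and, if $p(a)>0$, $p(x|a)=\pi_0(x)p(a|x)/p(a)$; conditions and sums involving $p(x|a)$ range over actions $a$ with $p(a)>0$. Surrogate expected utility: $G(p,U)=\sum_{a\in A}p(a)\max_{b\in A}\sum_{x\in X}p(x|a)U(x,b)$. NIAS: $\sum_{x}p_k(x|a)\big(U_k(x,a)-U_k(x,b)\big)\ge0$ for all $k$ and all $a\neq b$ in $A$ with $p_k(a)>0$. Attention strategies: for a finite set $Y$ of private signals (not observed by the analyst), an attention strategy is a map $\alpha:X\to\Delta(Y)$. It induces $p_\alpha(y)=\sum_x\pi_0(x)\alpha(y|x)$ and, when $p_\alpha(y)>0$, the posterior $\pi_y(x)=\pi_0(x)\alpha(y|x)/p_\alpha(y)$. Expected utility: $J(\alpha,U)=\sum_y p_\alpha(y)\max_{a\in A}\sum_x\pi_y(x)U(x,a)$ (sum over $y$ with $p_\alpha(y)>0$). Data-matching condition: there exist a finite signal set $Y$, attention strategies $\alpha_k:X\to\Delta(Y)$ and conditional action policies $\eta_k:Y\to\Delta(A)$ with $p_k(a|x)=\sum_{y}\eta_k(a|y)\alpha_k(y|x)$ for all $k,a,x$. Blackwell order: for kernels $\alpha,\bar\alpha:X\to\Delta(Y)$ (in particular for action selection policies, with $Y=A$), $\alpha$ Blackwell dominates $\bar\alpha$ if $\bar\alpha=\alpha Q$ for some row-stochastic matrix $Q$, i.e. $\bar\alpha(y|x)=\sum_{y'}\alpha(y'|x)Q_{y',y}$.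 A functional $C$ is monotone with respect to the Blackwell order if $C(\alpha)\ge C(\bar\alpha)$ whenever $\alpha$ Blackwell dominates $\bar\alpha$. Rationalization: a real-valued cost $C$ on attention strategies $X\to\Delta(Y)$, for some finite signal set $Y$, rationalizes $\mathcal{D}_{RRI}$ if there are scalars $\lambda_k>0$, attention strategies $\alpha_k:X\to\Delta(Y)$ and conditional action policies $\eta_k:Y\to\Delta(A)$ such that for every $k$: (i) $p_k(a|x)=\sum_y\eta_k(a|y)\alpha_k(y|x)$ for all $a,x$; (ii) for every $y$ with positive probability under $\alpha_k$, $\eta_k(\cdot|y)$ maximizes $\sum_x\pi_y(x)\sum_a q(a)U_k(x,a)$ over $q\in\Delta(A)$, where $\pi_y$ is the posterior under $\alpha_k$; (iii) $\alpha_k\in\operatorname{argmax}_{\alpha:X\to\Delta(Y)}\ \lambda_kJ(\alpha,U_k)-C(\alpha)$. *)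

theory Defs
  imports "HOL-Probability.Probability_Mass_Function"
begin

(* States and actions are the elements of finite types 'x and 'a, so that Delta(A) is
   the type 'a pmf and an action selection policy has type 'x => 'a pmf.  A signal set is a finite
   set Y inside a type 'y; a kernel X -> Delta(Y) is a function 'x => 'y pmf whose
   values are supported in Y. *)

definition attention_strategies :: "'y set \<Rightarrow> ('x \<Rightarrow> 'y pmf) set" where
  "attention_strategies Y = {\<alpha>. \<forall>x. set_pmf (\<alpha> x) \<subseteq> Y}"

definition signal_prob :: "'x::finite pmf \<Rightarrow> ('x \<Rightarrow> 'y pmf) \<Rightarrow> 'y \<Rightarrow> real" where
  "signal_prob prior \<alpha> y = (\<Sum>x\<in>UNIV. pmf prior x * pmf (\<alpha> x) y)"

(* Only meaningful where signal_prob is positive; all uses below are guarded accordingly. *)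
definition posterior :: "'x::finite pmf \<Rightarrow> ('x \<Rightarrow> 'y pmf) \<Rightarrow> 'y \<Rightarrow> 'x \<Rightarrow> real" where
  "posterior prior \<alpha> y x = pmf prior x * pmf (\<alpha> x) y / signal_prob prior \<alpha> y"

(* J(alpha, U) *)
definition expected_utility ::
  "'x::finite pmf \<Rightarrow> 'y set \<Rightarrow> ('x \<Rightarrow> 'y pmf) \<Rightarrow> ('x \<Rightarrow> 'a::finite \<Rightarrow> real) \<Rightarrow> real" where
  "expected_utility prior Y \<alpha> U =
     (\<Sum>y\<in>{y\<in>Y. 0 < signal_prob prior \<alpha> y}.
        signal_prob prior \<alpha> y * (MAX a. \<Sum>x\<in>UNIV. posterior prior \<alpha> y x * U x a))"

(* G(p, U): signal_prob and posterior of an action selection policy are p(a) and p(x|a). *)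
definition surrogate_utility ::
  "'x::finite pmf \<Rightarrow> ('x \<Rightarrow> 'a::finite pmf) \<Rightarrow> ('x \<Rightarrow> 'a \<Rightarrow> real) \<Rightarrow> real" where
  "surrogate_utility prior p U =
     (\<Sum>a\<in>{a. 0 < signal_prob prior p a}.
        signal_prob prior p a * (MAX b. \<Sum>x\<in>UNIV. posterior prior p a x * U x b))"

definition blackwell_dominates :: "'y set \<Rightarrow> ('x \<Rightarrow> 'y pmf) \<Rightarrow> ('x \<Rightarrow> 'y pmf) \<Rightarrow> bool" where
  "blackwell_dominates Y \<alpha> \<beta> \<longleftrightarrow>
     (\<exists>Q :: 'y \<Rightarrow> 'y pmf. (\<forall>y\<in>Y. set_pmf (Q y) \<subseteq> Y) \<and>
        (\<forall>x. \<forall>y\<in>Y. pmf (\<beta> x) y = (\<Sum>y'\<in>Y. pmf (\<alpha> x) y' * pmf (Q y') y)))"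

definition blackwell_monotone :: "'y set \<Rightarrow> (('x \<Rightarrow> 'y pmf) \<Rightarrow> real) \<Rightarrow> bool" where
  "blackwell_monotone Y C \<longleftrightarrow>
     (\<forall>\<alpha>\<in>attention_strategies Y. \<forall>\<beta>\<in>attention_strategies Y.
        blackwell_dominates Y \<alpha> \<beta> \<longrightarrow> C \<beta> \<le> C \<alpha>)"

definition matches_data ::
  "nat \<Rightarrow> (nat \<Rightarrow> 'x \<Rightarrow> 'a pmf) \<Rightarrow> 'y set \<Rightarrow> (nat \<Rightarrow> 'x \<Rightarrow> 'y pmf) \<Rightarrow> (nat \<Rightarrow> 'y \<Rightarrow> 'a pmf) \<Rightarrow> bool"
  where
  "matches_data K p Y \<alpha> \<eta> \<longleftrightarrow>
     (\<forall>k\<in>{1..K}. \<forall>a x. pmf (p k x) a = (\<Sum>y\<in>Y. pmf (\<eta> k y) a * pmf (\<alpha> k x) y))"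

(* HOL cannot quantify existentially over types; since every finite set is in bijection with a
   finite set of naturals, an arbitrary finite signal set is taken inside nat. *)
definition data_matching :: "nat \<Rightarrow> (nat \<Rightarrow> 'x \<Rightarrow> 'a pmf) \<Rightarrow> bool" where
  "data_matching K p \<longleftrightarrow>
     (\<exists>(Y :: nat set) \<alpha> \<eta>. finite Y \<and> (\<forall>k\<in>{1..K}. \<alpha> k \<in> attention_strategies Y) \<and>
        matches_data K p Y \<alpha> \<eta>)"

definition NIAS ::
  "'x::finite pmf \<Rightarrow> nat \<Rightarrow> (nat \<Rightarrow> 'x \<Rightarrow> 'a pmf) \<Rightarrow> (nat \<Rightarrow> 'x \<Rightarrow> 'a \<Rightarrow> real) \<Rightarrow> bool" where
  "NIAS prior K p U \<longleftrightarrow>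
     (\<forall>k\<in>{1..K}. \<forall>a b. a \<noteq> b \<longrightarrow> 0 < signal_prob prior (p k) a \<longrightarrow>
        (\<Sum>x\<in>UNIV. posterior prior (p k) a x * (U k x a - U k x b)) \<ge> 0)"

(* p_k >=_H p_j, witnessed by the list i_1, ..., i_L *)
definition revealed_geq ::
  "'x::finite pmf \<Rightarrow> nat \<Rightarrow> (nat \<Rightarrow> 'x \<Rightarrow> 'a::finite pmf) \<Rightarrow> (nat \<Rightarrow> 'x \<Rightarrow> 'a \<Rightarrow> real) \<Rightarrow>
   nat \<Rightarrow> nat \<Rightarrow> bool" where
  "revealed_geq prior K p U k j \<longleftrightarrow>
     (\<exists>idx. idx \<noteq> [] \<and> set idx \<subseteq> {1..K} \<and>
        successively
          (\<lambda>i i'. surrogate_utility prior (p i') (U i) \<ge> surrogate_utility prior (p i) (U i))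
          (k # idx @ [j]))"

definition GARRI ::
  "'x::finite pmf \<Rightarrow> nat \<Rightarrow> (nat \<Rightarrow> 'x \<Rightarrow> 'a::finite pmf) \<Rightarrow> (nat \<Rightarrow> 'x \<Rightarrow> 'a \<Rightarrow> real) \<Rightarrow> bool" where
  "GARRI prior K p U \<longleftrightarrow>
     (\<forall>k\<in>{1..K}. \<forall>j\<in>{1..K}. k \<noteq> j \<longrightarrow> revealed_geq prior K p U k j \<longrightarrow>
        surrogate_utility prior (p k) (U j) \<le> surrogate_utility prior (p j) (U j))"

definition rationalizes_with ::
  "'x::finite pmf \<Rightarrow> nat \<Rightarrow> (nat \<Rightarrow> 'x \<Rightarrow> 'a::finite pmf) \<Rightarrow> (nat \<Rightarrow> 'x \<Rightarrow> 'a \<Rightarrow> real) \<Rightarrow>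
   'y set \<Rightarrow> (('x \<Rightarrow> 'y pmf) \<Rightarrow> real) \<Rightarrow>
   (nat \<Rightarrow> real) \<Rightarrow> (nat \<Rightarrow> 'x \<Rightarrow> 'y pmf) \<Rightarrow> (nat \<Rightarrow> 'y \<Rightarrow> 'a pmf) \<Rightarrow> bool" where
  "rationalizes_with prior K p U Y C lam \<alpha> \<eta> \<longleftrightarrow>
     (\<forall>k\<in>{1..K}. 0 < lam k) \<and>
     matches_data K p Y \<alpha> \<eta> \<and>
     (\<forall>k\<in>{1..K}. \<forall>y\<in>Y. 0 < signal_prob prior (\<alpha> k) y \<longrightarrow>
        is_arg_max
          (\<lambda>q. \<Sum>x\<in>UNIV. posterior prior (\<alpha> k) y x * (\<Sum>a\<in>UNIV. pmf q a * U k x a))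
          (\<lambda>q. True) (\<eta> k y)) \<and>
     (\<forall>k\<in>{1..K}.
        is_arg_max (\<lambda>\<beta>. lam k * expected_utility prior Y \<beta> (U k) - C \<beta>)
          (\<lambda>\<beta>. \<beta> \<in> attention_strategies Y) (\<alpha> k))"

definition rationalizes ::
  "'x::finite pmf \<Rightarrow> nat \<Rightarrow> (nat \<Rightarrow> 'x \<Rightarrow> 'a::finite pmf) \<Rightarrow> (nat \<Rightarrow> 'x \<Rightarrow> 'a \<Rightarrow> real) \<Rightarrow>
   'y set \<Rightarrow> (('x \<Rightarrow> 'y pmf) \<Rightarrow> real) \<Rightarrow> bool" where
  "rationalizes prior K p U Y C \<longleftrightarrow> (\<exists>lam \<alpha> \<eta>. rationalizes_with prior K p U Y C lam \<alpha> \<eta>)"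

definition afriat_inequalities ::
  "'x::finite pmf \<Rightarrow> nat \<Rightarrow> (nat \<Rightarrow> 'x \<Rightarrow> 'a::finite pmf) \<Rightarrow> (nat \<Rightarrow> 'x \<Rightarrow> 'a \<Rightarrow> real) \<Rightarrow>
   (nat \<Rightarrow> real) \<Rightarrow> (nat \<Rightarrow> real) \<Rightarrow> bool" where
  "afriat_inequalities prior K p U lam c \<longleftrightarrow>
     (\<forall>k\<in>{1..K}. \<forall>j\<in>{1..K}. k \<noteq> j \<longrightarrow>
        lam k * (\<Sum>x\<in>UNIV. \<Sum>a\<in>UNIV. pmf (p k x) a * pmf prior x * U k x a) - c k
        \<ge> lam k * surrogate_utility prior (p j) (U k) - c j)"

definition cost_piece ::
  "'x::finite pmf \<Rightarrow> (nat \<Rightarrow> 'x \<Rightarrow> 'a::finite pmf) \<Rightarrow> (nat \<Rightarrow> 'x \<Rightarrow> 'a \<Rightarrow> real) \<Rightarrow>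
   (nat \<Rightarrow> real) \<Rightarrow> (nat \<Rightarrow> real) \<Rightarrow> nat \<Rightarrow> ('x \<Rightarrow> 'a pmf) \<Rightarrow> real" where
  "cost_piece prior p U lam c k q =
     c k + lam k * (surrogate_utility prior q (U k) - surrogate_utility prior (p k) (U k))"

definition reconstructed_cost ::
  "'x::finite pmf \<Rightarrow> nat \<Rightarrow> (nat \<Rightarrow> 'x \<Rightarrow> 'a::finite pmf) \<Rightarrow> (nat \<Rightarrow> 'x \<Rightarrow> 'a \<Rightarrow> real) \<Rightarrow>
   (nat \<Rightarrow> real) \<Rightarrow> (nat \<Rightarrow> real) \<Rightarrow> ('x \<Rightarrow> 'a pmf) \<Rightarrow> real" where
  "reconstructed_cost prior K p U lam c q = (MAX k\<in>{1..K}. cost_piece prior p U lam c k q)"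

(* The policy theta p' + (1 - theta) p''; see pmf_mix_policy. *)
definition mix_policy :: "real \<Rightarrow> ('x \<Rightarrow> 'a pmf) \<Rightarrow> ('x \<Rightarrow> 'a pmf) \<Rightarrow> 'x \<Rightarrow> 'a pmf" where
  "mix_policy \<theta> p' p'' x = bind_pmf (bernoulli_pmf \<theta>) (\<lambda>b. if b then p' x else p'' x)"

lemma pmf_mix_policy:
  assumes "\<theta> \<in> {0..1}"
  shows "pmf (mix_policy \<theta> p' p'' x) a = \<theta> * pmf (p' x) a + (1 - \<theta>) * pmf (p'' x) a"
  using assms by (simp add: mix_policy_def pmf_bind)

definition convex_in_policy :: "(('x \<Rightarrow> 'a pmf) \<Rightarrow> real) \<Rightarrow> bool" where
  "convex_in_policy F \<longleftrightarrow>
     (\<forall>p' p''. \<forall>\<theta>\<in>{0..1}. F (mix_policy \<theta> p' p'') \<le> \<theta> * F p' + (1 - \<theta>) * F p'')"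

end

theory Submission
  imports Defs
begin

text \<open>
  Writing \<open>v\<^sub>\<alpha>(y, b) = \<Sum>\<^sub>x \<pi>\<^sub>0(x) \<alpha>(y|x) U(x, b)\<close>, the expected utility is
  \<open>J(\<alpha>, U) = \<Sum>\<^sub>y max\<^sub>b v\<^sub>\<alpha>(y, b)\<close>, which is convex in \<open>\<alpha>\<close> and decreases under garbling because a
  maximum of sums is at most the sum of the maxima. NIAS says that the recommended action \<open>a\<close>
  attains \<open>max\<^sub>b v(a, b)\<close>, so that \<open>G(p\<^sub>k, U\<^sub>k)\<close> is the realised utility.

  If \<open>C\<close> rationalizes the data through \<open>\<alpha>\<^sub>k\<close>, then \<open>J(\<alpha>\<^sub>k, U\<^sub>k) = G(p\<^sub>k, U\<^sub>k)\<close> by optimality of the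
  actions and \<open>J(\<alpha>\<^sub>j, U\<^sub>k) \<ge> G(p\<^sub>j, U\<^sub>k)\<close> since \<open>p\<^sub>j\<close> is a garbling of \<open>\<alpha>\<^sub>j\<close>; hence \<open>c\<^sub>k = C(\<alpha>\<^sub>k) + 1\<close>
  solves the inequalities of 3). These imply GARRI because \<open>c\<close> increases along revealed preference
  chains. Conversely, GARRI is the hypothesis of Afriat's lemma for the matrix
  \<open>G(p\<^sub>j, U\<^sub>k) - G(p\<^sub>k, U\<^sub>k)\<close>, and any solution makes each \<open>p\<^sub>k\<close> optimal for the maximum of the
  functions \<open>c\<^sub>k + \<lambda>\<^sub>k (J(\<cdot>, U\<^sub>k) - G(p\<^sub>k, U\<^sub>k))\<close>.
\<close>

section \<open>Afriat's lemma\<close>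

text \<open>Choose \<open>m\<close> with the fewest reachable points in \<open>I\<close>. Whatever
  \<open>m\<close> reaches has no larger reachable set, hence by minimality the same one, and that
  set contains \<open>m\<close>.\<close>

lemma ex_final_class:
  assumes "finite I" "I \<noteq> {}"
  shows "\<exists>m\<in>I. \<forall>j\<in>I. (m, j) \<in> R\<^sup>* \<longrightarrow> (j, m) \<in> R\<^sup>*"
proof -
  let ?reach = "\<lambda>m. {j \<in> I. (m, j) \<in> R\<^sup>*}"
  obtain m where m: "m \<in> I" "\<And>j. j \<in> I \<Longrightarrow> card (?reach m) \<le> card (?reach j)"
    using assms ex_min_if_finite[of "(\<lambda>m. card (?reach m)) ` I"] by (auto simp: not_less)
  have "(j, m) \<in> R\<^sup>*" if j: "j \<in> I" "(m, j) \<in> R\<^sup>*" for j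
  proof -
    have "?reach j \<subseteq> ?reach m"
      using j by (auto intro: rtrancl_trans)
    then have "?reach j = ?reach m"
      using m(2)[OF j(1)] assms(1) by (intro card_seteq) auto
    then show ?thesis
      using m(1) by auto
  qed
  with m(1) show ?thesis
    by blast
qed

text \<open>
  Peel off a class \<open>E\<close> from which the rest is not reachable: there \<open>a\<close> is nonpositive inside \<open>E\<close> and
  negative from \<open>E\<close> to the outside, so on \<open>E\<close> a large constant \<open>u\<close> and large \<open>\<mu>\<close> work.
\<close>

lemma afriat:
  fixes a :: "'i \<Rightarrow> 'i \<Rightarrow> real"
  assumes "finite I"
    and "\<And>i j. i \<in> I \<Longrightarrow> j \<in> I \<Longrightarrow> (i, j) \<in> {(i, j). i \<in> I \<and> j \<in> I \<and> 0 \<le> a i j}\<^sup>* \<Longrightarrow> a j i \<le> 0"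
  shows "\<exists>\<mu> u. \<forall>i\<in>I. 0 < \<mu> i \<and> 0 < u i \<and> (\<forall>j\<in>I. \<mu> i * a i j \<le> u j - u i)"
  using assms
proof (induction I rule: finite_psubset_induct)
  case (psubset I)
  let ?R = "\<lambda>I. {(i, j). i \<in> I \<and> j \<in> I \<and> 0 \<le> a i j}"
  show ?case
  proof (cases "I = {}")
    case False
    then obtain m where m: "m \<in> I" "\<And>j. j \<in> I \<Longrightarrow> (m, j) \<in> (?R I)\<^sup>* \<Longrightarrow> (j, m) \<in> (?R I)\<^sup>*"
      using ex_final_class[of I "?R I"] psubset.hyps by blast
    define E where "E = {j \<in> I. (m, j) \<in> (?R I)\<^sup>*}"
    have E: "E \<subseteq> I" "m \<in> E" "finite E"
      using m(1) psubset.hyps by (auto simp: E_def)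
    \<comment> \<open>By the choice of \<open>m\<close> any two members of \<open>E\<close> reach
      each other, so the hypothesis applies to the path from \<open>j\<close> back to
      \<open>i\<close>.\<close>
    have inside: "a i j \<le> 0" if "i \<in> E" "j \<in> E" for i j
    proof -
      have "(j, i) \<in> (?R I)\<^sup>*"
        using that m(2)[of j] by (auto simp: E_def intro: rtrancl_trans)
      then show ?thesis
        using psubset.prems[of j i] that E(1) by blast
    qed
    have outside: "a i j < 0" if "i \<in> E" "j \<in> I - E" for i j
    proof (rule ccontr)
      assume "\<not> a i j < 0"
      then have "(i, j) \<in> ?R I"
        using that E(1) by auto
      then have "(m, j) \<in> (?R I)\<^sup>*"
        using that(1) by (auto simp: E_def intro: rtrancl_into_rtrancl)
      then show False
        using that by (auto simp: E_def)
    qed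
    \<comment> \<open>Deleting \<open>E\<close> only deletes paths, so the hypothesis on paths
      survives for the induction.\<close>
    have "?R (I - E) \<subseteq> ?R I"
      by auto
    then have "a j i \<le> 0" if "i \<in> I - E" "j \<in> I - E" "(i, j) \<in> (?R (I - E))\<^sup>*" for i j
      using that rtrancl_mono[of "?R (I - E)" "?R I"] psubset.prems[of i j] by blast
    moreover have "I - E \<subset> I"
      using E by blast
    ultimately obtain \<mu> u where IH: "\<And>i. i \<in> I - E \<Longrightarrow> 0 < \<mu> i \<and> 0 < u i"
        "\<And>i j. i \<in> I - E \<Longrightarrow> j \<in> I - E \<Longrightarrow> \<mu> i * a i j \<le> u j - u i"
      using psubset.IH[of "I - E"] by blast
    \<comment> \<open>The level of \<open>u'\<close> on \<open>E\<close> must exceed all these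
      values for the inequalities that lead from \<open>I - E\<close> into \<open>E\<close>. The
      inserted 1 keeps the level positive and the set nonempty.\<close>
    define T where "T = insert 1 ((\<lambda>(i, j). u i + \<mu> i * a i j) ` ((I - E) \<times> E))"
    define t where "t = Max T"
    have T: "finite T"
      using psubset.hyps E(3) by (auto simp: T_def)
    have t_pos: "1 \<le> t"
      using T by (auto simp: t_def T_def)
    have t_ge: "u i + \<mu> i * a i j \<le> t" if "i \<in> I - E" "j \<in> E" for i j
      unfolding t_def using that by (intro Max_ge[OF T]) (auto simp: T_def)
    \<comment> \<open>Since \<open>a i j\<close> is negative here, the inequality from
      \<open>E\<close> to the outside is a lower bound on the multiplier; division by
      \<open>a i j\<close> gives the bound. The inserted 1 again ensures positivity.\<close>
    define M where "M i = insert 1 ((\<lambda>j. (u j - t) / a i j) ` (I - E))" for i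
    have M: "finite (M i)" for i
      using psubset.hyps by (auto simp: M_def)
    have M_pos: "0 < Max (M i)" for i
      using Max_ge[OF M, of 1 i] by (auto simp: M_def)
    have M_ge: "Max (M i) * a i j \<le> u j - t" if "i \<in> E" "j \<in> I - E" for i j
    proof -
      have "(u j - t) / a i j \<le> Max (M i)"
        using that by (intro Max_ge[OF M]) (auto simp: M_def)
      then show ?thesis
        using outside[OF that] by (simp add: neg_divide_le_eq)
    qed
    define \<mu>' where "\<mu>' i = (if i \<in> E then Max (M i) else \<mu> i)" for i
    define u' where "u' i = (if i \<in> E then t else u i)" for i
    \<comment> \<open>Four cases: within \<open>E\<close> the right side is 0 and
      \<open>inside\<close> applies; leaving \<open>E\<close> uses \<open>M_ge\<close>, entering it
      \<open>t_ge\<close>, and staying outside the induction hypothesis.\<close>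
    have "\<mu>' i * a i j \<le> u' j - u' i" if "i \<in> I" "j \<in> I" for i j
      using that inside[of i j] M_ge[of i j] t_ge[of i j] IH(2)[of i j] less_imp_le[OF M_pos, of i]
      by (auto simp: \<mu>'_def u'_def mult_nonneg_nonpos)
    moreover have "0 < \<mu>' i \<and> 0 < u' i" if "i \<in> I" for i
      using that IH(1)[of i] M_pos t_pos by (auto simp: \<mu>'_def u'_def)
    ultimately show ?thesis
      by blast
  qed simp
qed

text \<open>Connects the closure in Afriat's lemma with the chains of \<open>revealed_geq\<close>,
  which have at least one intermediate index. Reflexivity at \<open>k\<close> lets \<open>k\<close>
  itself be that index on the empty path.\<close>

lemma rtrancl_imp_successively:
  assumes "(k, j) \<in> {(i, j). i \<in> I \<and> j \<in> I \<and> P i j}\<^sup>*" "k \<in> I" "P k k"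
  shows "\<exists>idx. idx \<noteq> [] \<and> set idx \<subseteq> I \<and> successively P (k # idx @ [j])"
  using assms
proof (induction rule: rtrancl_induct)
  case base
  then show ?case
    by (intro exI[of _ "[k]"]) auto
next
  case (step j j')
  then obtain idx where "idx \<noteq> []" "set idx \<subseteq> I" "successively P (k # idx @ [j])"
    by blast
  with step.hyps(2) show ?case
    by (intro exI[of _ "idx @ [j]"]) (auto simp: successively_append_iff successively_Cons)
qed

lemma successively_imp_le:
  fixes c :: "'i \<Rightarrow> real"
  assumes "successively P (k # idx @ [j])" "k \<in> I" "set idx \<subseteq> I" "j \<in> I"
    and "\<And>i i'. i \<in> I \<Longrightarrow> i' \<in> I \<Longrightarrow> P i i' \<Longrightarrow> c i \<le> c i'"
  shows "c k \<le> c j"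
  using assms(1-4)
proof (induction idx arbitrary: k)
  case Nil
  then show ?case
    using assms(5) by simp
next
  case (Cons i idx)
  then have "c k \<le> c i" "c i \<le> c j"
    using assms(5)[of k i] by auto
  then show ?case
    by simp
qed

section \<open>Value of information\<close>

text \<open>Without normalisation by the signal probability the payoff is linear in the kernel and
  vanishes at null signals, so no guards or divisions remain.\<close>

definition joint_payoff ::
  "'x::finite pmf \<Rightarrow> ('x \<Rightarrow> 'y pmf) \<Rightarrow> ('x \<Rightarrow> 'a \<Rightarrow> real) \<Rightarrow> 'y \<Rightarrow> 'a \<Rightarrow> real" where
  "joint_payoff prior \<alpha> U y b = (\<Sum>x\<in>UNIV. pmf prior x * pmf (\<alpha> x) y * U x b)"

lemma posterior_payoff:
  "(\<Sum>x\<in>UNIV. posterior prior \<alpha> y x * U x b) =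
     joint_payoff prior \<alpha> U y b / signal_prob prior \<alpha> y"
  by (simp add: posterior_def joint_payoff_def sum_divide_distrib)

lemma signal_prob_nonneg: "0 \<le> signal_prob prior \<alpha> y"
  by (simp add: signal_prob_def sum_nonneg)

lemma joint_payoff_null:
  assumes "\<not> 0 < signal_prob prior \<alpha> y"
  shows "joint_payoff prior \<alpha> U y b = 0"
proof -
  have "signal_prob prior \<alpha> y = 0"
    using assms signal_prob_nonneg[of prior \<alpha> y] by simp
  then have "\<forall>x. pmf prior x * pmf (\<alpha> x) y = 0"
    unfolding signal_prob_def by (subst (asm) sum_nonneg_eq_0_iff) auto
  then show ?thesis
    by (auto simp: joint_payoff_def intro!: sum.neutral)
qed

text \<open>Division by a positive probability commutes with the maximum, and null signals add a
  maximum of zeros.\<close>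

lemma expected_utility_eq:
  fixes U :: "'x::finite \<Rightarrow> 'a::finite \<Rightarrow> real"
  assumes "finite Y"
  shows "expected_utility prior Y \<alpha> U = (\<Sum>y\<in>Y. MAX b. joint_payoff prior \<alpha> U y b)"
proof -
  let ?s = "signal_prob prior \<alpha>" and ?v = "joint_payoff prior \<alpha> U"
  have "(MAX b. ?v y b / ?s y) = (MAX b. ?v y b) / ?s y" if "0 < ?s y" for y
    using that mono_Max_commute[of "\<lambda>t. t / ?s y" "range (?v y)"]
    by (simp add: mono_def divide_right_mono image_image)
  then have "expected_utility prior Y \<alpha> U = (\<Sum>y\<in>{y\<in>Y. 0 < ?s y}. MAX b. ?v y b)"
    unfolding expected_utility_def posterior_payoff by (intro sum.cong) auto
  also have "\<dots> = (\<Sum>y\<in>Y. MAX b. ?v y b)"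
    using assms by (intro sum.mono_neutral_left) (auto simp: joint_payoff_null)
  finally show ?thesis .
qed

lemma expected_utility_UNIV: "expected_utility prior UNIV q U = surrogate_utility prior q U"
  by (simp add: expected_utility_def surrogate_utility_def)

lemma surrogate_utility_eq:
  "surrogate_utility prior q U = (\<Sum>a\<in>UNIV. MAX b. joint_payoff prior q U a b)"
  by (simp flip: expected_utility_UNIV add: expected_utility_eq)

lemma joint_payoff_garble:
  assumes "\<And>x. pmf (\<beta> x) z = (\<Sum>y\<in>Y. pmf (\<alpha> x) y * Q y)"
  shows "joint_payoff prior \<beta> U z b = (\<Sum>y\<in>Y. Q y * joint_payoff prior \<alpha> U y b)"
proof -
  have "joint_payoff prior \<beta> U z b =
      (\<Sum>x\<in>UNIV. \<Sum>y\<in>Y. Q y * (pmf prior x * pmf (\<alpha> x) y * U x b))"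
    by (simp add: joint_payoff_def assms sum_distrib_left sum_distrib_right mult_ac)
  also have "\<dots> = (\<Sum>y\<in>Y. Q y * joint_payoff prior \<alpha> U y b)"
    by (subst sum.swap) (simp add: joint_payoff_def sum_distrib_left)
  finally show ?thesis .
qed

text \<open>The maximum of a weighted sum is at most the weighted sum of the maxima, and for each
  \<open>y\<close> the weights \<open>pmf (Q y) z\<close> sum to 1 over \<open>z\<close>. The two
  signal types may differ, so an attention strategy can also be compared with the action policy it
  induces.\<close>

lemma expected_utility_garble:
  fixes U :: "'x::finite \<Rightarrow> 'a::finite \<Rightarrow> real"
  assumes fin: "finite Y" "finite Z"
    and supp: "\<And>y. y \<in> Y \<Longrightarrow> set_pmf (Q y) \<subseteq> Z"
    and garble: "\<And>x z. z \<in> Z \<Longrightarrow> pmf (\<beta> x) z = (\<Sum>y\<in>Y. pmf (\<alpha> x) y * pmf (Q y) z)"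
  shows "expected_utility prior Z \<beta> U \<le> expected_utility prior Y \<alpha> U"
proof -
  let ?v = "joint_payoff prior \<alpha> U"
  have "(MAX b. joint_payoff prior \<beta> U z b) \<le> (\<Sum>y\<in>Y. pmf (Q y) z * (MAX b. ?v y b))"
    if "z \<in> Z" for z
    by (auto simp: joint_payoff_garble[where \<alpha> = \<alpha>, OF garble[OF that]]
        intro!: Max.boundedI sum_mono mult_left_mono Max_ge)
  then have "expected_utility prior Z \<beta> U \<le> (\<Sum>z\<in>Z. \<Sum>y\<in>Y. pmf (Q y) z * (MAX b. ?v y b))"
    by (simp add: expected_utility_eq fin sum_mono)
  also have "\<dots> = (\<Sum>y\<in>Y. (\<Sum>z\<in>Z. pmf (Q y) z) * (MAX b. ?v y b))"
    by (subst sum.swap) (simp add: sum_distrib_right)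
  also have "\<dots> = expected_utility prior Y \<alpha> U"
    by (simp add: expected_utility_eq fin sum_pmf_eq_1 supp)
  finally show ?thesis .
qed

lemma expected_utility_blackwell:
  fixes U :: "'x::finite \<Rightarrow> 'a::finite \<Rightarrow> real"
  assumes "finite Y" "blackwell_dominates Y \<alpha> \<beta>"
  shows "expected_utility prior Y \<beta> U \<le> expected_utility prior Y \<alpha> U"
proof -
  obtain Q where "\<forall>y\<in>Y. set_pmf (Q y) \<subseteq> Y"
      "\<forall>x. \<forall>y\<in>Y. pmf (\<beta> x) y = (\<Sum>y'\<in>Y. pmf (\<alpha> x) y' * pmf (Q y') y)"
    using assms(2) by (auto simp: blackwell_dominates_def)
  then show ?thesis
    using assms(1) by (intro expected_utility_garble[where Q = Q]) auto
qed

text \<open>The unnormalised payoff is affine in the policy, and a maximum of affine functions is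
  convex.\<close>

lemma surrogate_utility_mix:
  assumes "\<theta> \<in> {0..1}"
  shows "surrogate_utility prior (mix_policy \<theta> p' p'') U
    \<le> \<theta> * surrogate_utility prior p' U + (1 - \<theta>) * surrogate_utility prior p'' U"
proof -
  let ?v = "\<lambda>q. joint_payoff prior q U"
  have mix: "?v (mix_policy \<theta> p' p'') a b = \<theta> * ?v p' a b + (1 - \<theta>) * ?v p'' a b" for a b
    by (simp add: joint_payoff_def pmf_mix_policy[OF assms] sum_distrib_left flip: sum.distrib)
      (simp add: algebra_simps)
  have "(MAX b. ?v (mix_policy \<theta> p' p'') a b)
      \<le> \<theta> * (MAX b. ?v p' a b) + (1 - \<theta>) * (MAX b. ?v p'' a b)" for a
    using assms by (auto simp: mix intro!: Max.boundedI add_mono mult_left_mono Max_ge)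
  then show ?thesis
    by (simp add: surrogate_utility_eq sum_distrib_left sum_mono flip: sum.distrib)
qed

text \<open>Relabelling loses no information; this lets actions be encoded as natural-number
  signals.\<close>

lemma expected_utility_map_inj:
  fixes U :: "'x::finite \<Rightarrow> 'a::finite \<Rightarrow> real" and f :: "'a \<Rightarrow> 'y"
  assumes "inj f"
  shows "expected_utility prior (range f) (\<lambda>x. map_pmf f (q x)) U = surrogate_utility prior q U"
proof -
  have "joint_payoff prior (\<lambda>x. map_pmf f (q x)) U (f a) b = joint_payoff prior q U a b" for a b
    by (simp add: joint_payoff_def pmf_map_inj'[OF assms])
  then show ?thesis
    by (simp add: expected_utility_eq surrogate_utility_eq sum.reindex[OF assms])
qed

section \<open>Optimality of actions\<close>

text \<open>For recommended actions of positive probability the normalisation cancels; at null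
  actions and for \<open>a = b\<close> the comparison is trivial, so both guards disappear.\<close>

lemma NIAS_iff:
  "NIAS prior K p U \<longleftrightarrow>
     (\<forall>k\<in>{1..K}. \<forall>a b. joint_payoff prior (p k) (U k) a b \<le> joint_payoff prior (p k) (U k) a a)"
proof -
  have "(a \<noteq> b \<longrightarrow> 0 < signal_prob prior (p k) a \<longrightarrow>
        0 \<le> (\<Sum>x\<in>UNIV. posterior prior (p k) a x * (U k x a - U k x b))) \<longleftrightarrow>
      joint_payoff prior (p k) (U k) a b \<le> joint_payoff prior (p k) (U k) a a" for k a b
    by (cases "0 < signal_prob prior (p k) a")
      (auto simp: right_diff_distrib sum_subtractf posterior_payoff divide_le_cancel
        joint_payoff_null)
  then show ?thesis
    by (simp only: NIAS_def)
qed

lemma NIAS_Max: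
  fixes p :: "nat \<Rightarrow> 'x::finite \<Rightarrow> 'a::finite pmf"
  assumes "NIAS prior K p U" "k \<in> {1..K}"
  shows "(MAX b. joint_payoff prior (p k) (U k) a b) = joint_payoff prior (p k) (U k) a a"
  using assms by (intro Max_eqI) (auto simp: NIAS_iff)

lemma NIAS_surrogate_utility:
  fixes p :: "nat \<Rightarrow> 'x::finite \<Rightarrow> 'a::finite pmf"
  assumes "NIAS prior K p U" "k \<in> {1..K}"
  shows "surrogate_utility prior (p k) (U k) =
    (\<Sum>x\<in>UNIV. \<Sum>a\<in>UNIV. pmf (p k x) a * pmf prior x * U k x a)"
proof -
  have "surrogate_utility prior (p k) (U k) = (\<Sum>a\<in>UNIV. joint_payoff prior (p k) (U k) a a)"
    unfolding surrogate_utility_eq NIAS_Max[OF assms] ..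
  then show ?thesis
    by (subst sum.swap) (simp add: joint_payoff_def mult_ac)
qed

text \<open>Under NIAS the realised utility is the surrogate utility of the own policy. The diagonal
  case reads 0 \<le> 0 and can be included.\<close>

lemma afriat_inequalities_iff:
  fixes p :: "nat \<Rightarrow> 'x::finite \<Rightarrow> 'a::finite pmf"
  assumes "NIAS prior K p U"
  shows "afriat_inequalities prior K p U lam c \<longleftrightarrow>
    (\<forall>k\<in>{1..K}. \<forall>j\<in>{1..K}. lam k *
       (surrogate_utility prior (p j) (U k) - surrogate_utility prior (p k) (U k)) \<le> c j - c k)"
proof -
  have "lam k * surrogate_utility prior (p k) (U k) - c k
        \<ge> lam k * surrogate_utility prior (p j) (U k) - c j \<longleftrightarrow>
      lam k * (surrogate_utility prior (p j) (U k) - surrogate_utility prior (p k) (U k)) \<le> c j - c k"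
    for k j
    by (auto simp: algebra_simps)
  then show ?thesis
    unfolding afriat_inequalities_def
    by (simp flip: NIAS_surrogate_utility[OF assms]) (metis diff_self mult_zero_right order_refl)
qed

lemma interchange_action:
  fixes u :: "'x::finite \<Rightarrow> 'a::finite \<Rightarrow> real"
  shows "(\<Sum>x\<in>UNIV. posterior prior \<alpha> y x * (\<Sum>a\<in>UNIV. pmf q a * u x a)) =
    (\<Sum>a\<in>UNIV. pmf q a * joint_payoff prior \<alpha> u y a) / signal_prob prior \<alpha> y"
proof -
  have "(\<Sum>x\<in>UNIV. posterior prior \<alpha> y x * (\<Sum>a\<in>UNIV. pmf q a * u x a)) =
      (\<Sum>a\<in>UNIV. pmf q a * (\<Sum>x\<in>UNIV. posterior prior \<alpha> y x * u x a))"
    by (simp add: sum_distrib_left mult_ac) (rule sum.swap)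
  then show ?thesis
    by (simp add: posterior_payoff sum_divide_distrib)
qed

lemma mean_le_Max:
  fixes w :: "'a::finite \<Rightarrow> real"
  shows "(\<Sum>a\<in>UNIV. pmf q a * w a) \<le> (MAX a. w a)"
proof -
  have "(\<Sum>a\<in>UNIV. pmf q a * w a) \<le> (\<Sum>a\<in>UNIV. pmf q a * (MAX a. w a))"
    by (intro sum_mono mult_left_mono Max_ge) auto
  also have "\<dots> = (MAX a. w a)"
    by (simp add: sum_pmf_eq_1 flip: sum_distrib_right)
  finally show ?thesis .
qed

text \<open>The weighted shortfalls from the maximum are nonnegative and sum to 0, so
  \<open>q\<close> charges only maximisers. The factor \<open>pmf q a\<close> covers the actions it
  does not charge.\<close>

lemma mean_eq_Max_imp:
  fixes w :: "'a::finite \<Rightarrow> real"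
  assumes "(\<Sum>a\<in>UNIV. pmf q a * w a) = (MAX a. w a)"
  shows "pmf q a * w b \<le> pmf q a * w a"
proof -
  let ?M = "MAX a. w a"
  have "(\<Sum>a\<in>UNIV. pmf q a * (?M - w a)) = 0"
    using assms by (simp add: right_diff_distrib sum_subtractf sum_pmf_eq_1 flip: sum_distrib_right)
  then have "pmf q a * (?M - w a) = 0"
    by (subst (asm) sum_nonneg_eq_0_iff) auto
  moreover have "pmf q a * w b \<le> pmf q a * ?M"
    by (intro mult_left_mono Max_ge) auto
  ultimately show ?thesis
    by auto
qed

lemma optimal_action_iff:
  fixes u :: "'x::finite \<Rightarrow> 'a::finite \<Rightarrow> real"
  assumes "0 < signal_prob prior \<alpha> y"
  shows "is_arg_max
      (\<lambda>q. \<Sum>x\<in>UNIV. posterior prior \<alpha> y x * (\<Sum>a\<in>UNIV. pmf q a * u x a)) (\<lambda>q. True) q \<longleftrightarrow>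
    (\<Sum>a\<in>UNIV. pmf q a * joint_payoff prior \<alpha> u y a) = (MAX a. joint_payoff prior \<alpha> u y a)"
    (is "?L \<longleftrightarrow> ?mean q = ?M")
proof -
  have "?L \<longleftrightarrow> (\<forall>r. ?mean r \<le> ?mean q)"
    using assms by (simp add: is_arg_max_def interchange_action not_less divide_le_cancel)
  also have "\<dots> \<longleftrightarrow> ?mean q = ?M"
  proof
    assume opt: "\<forall>r. ?mean r \<le> ?mean q"
    have "?M \<in> range (joint_payoff prior \<alpha> u y)"
      by (intro Max_in) auto
    then obtain b where "?M = joint_payoff prior \<alpha> u y b"
      by blast
    \<comment> \<open>The point mass on a maximiser attains the maximum, so an optimal mixed action
      must attain it too.\<close>
    also have "\<dots> = ?mean (return_pmf b)"
      by (simp add: pmf_return indicator_def if_distrib[of "\<lambda>t. t * _"] cong: if_cong)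
    finally show "?mean q = ?M"
      using opt mean_le_Max[of q] by (metis antisym)
  next
    assume "?mean q = ?M"
    then show "\<forall>r. ?mean r \<le> ?mean q"
      using mean_le_Max by metis
  qed
  finally show ?thesis .
qed

text \<open>Extends the criterion to null signals, where nothing is assumed about \<open>q\<close>
  but both sides are 0; sums over all of \<open>Y\<close> can then be treated uniformly.\<close>

lemma optimal_action_mean:
  fixes u :: "'x::finite \<Rightarrow> 'a::finite \<Rightarrow> real"
  assumes "0 < signal_prob prior \<alpha> y \<Longrightarrow> is_arg_max
      (\<lambda>q. \<Sum>x\<in>UNIV. posterior prior \<alpha> y x * (\<Sum>a\<in>UNIV. pmf q a * u x a)) (\<lambda>q. True) q"
  shows "(\<Sum>a\<in>UNIV. pmf q a * joint_payoff prior \<alpha> u y a) = (MAX a. joint_payoff prior \<alpha> u y a)"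
proof (cases "0 < signal_prob prior \<alpha> y")
  case True
  show ?thesis
    using assms[OF True] unfolding optimal_action_iff[OF True] .
next
  case False
  then show ?thesis
    by (simp add: joint_payoff_null)
qed

section \<open>Rationalization and the Afriat inequalities\<close>

text \<open>The added 1 cancels in the inequalities; it turns a nonnegative cost into strictly
  positive \<open>c\<close>.\<close>

lemma rationalizes_imp_afriat:
  fixes p :: "nat \<Rightarrow> 'x::finite \<Rightarrow> 'a::finite pmf"
  assumes fin: "finite Y" and rat: "rationalizes_with prior K p U Y C lam \<alpha> \<eta>"
  shows "NIAS prior K p U" "afriat_inequalities prior K p U lam (\<lambda>k. C (\<alpha> k) + 1)"
proof -
  let ?v = "\<lambda>k. joint_payoff prior (\<alpha> k) (U k)"
  have match: "pmf (p k x) a = (\<Sum>y\<in>Y. pmf (\<alpha> k x) y * pmf (\<eta> k y) a)" if "k \<in> {1..K}" for k x a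
    using rat that by (simp add: rationalizes_with_def matches_data_def mult.commute)
  have opt: "(\<Sum>a\<in>UNIV. pmf (\<eta> k y) a * ?v k y a) = (MAX a. ?v k y a)"
    if "k \<in> {1..K}" "y \<in> Y" for k y
    using rat that by (intro optimal_action_mean) (simp add: rationalizes_with_def)
  have pay: "joint_payoff prior (p k) (U k) a b = (\<Sum>y\<in>Y. pmf (\<eta> k y) a * ?v k y b)"
    if "k \<in> {1..K}" for k a b
    by (intro joint_payoff_garble match that)
  \<comment> \<open>The payoff after action \<open>a\<close> mixes signal payoffs with weights
    \<open>pmf (\<eta> k y) a\<close>. As \<open>\<eta> k y\<close> charges only maximisers,
    \<open>a\<close> beats \<open>b\<close> signal by signal.\<close>
  show NIAS: "NIAS prior K p U"
    unfolding NIAS_iff by (auto simp: pay intro!: sum_mono mean_eq_Max_imp opt)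
  have value_eq: "expected_utility prior Y (\<alpha> k) (U k) = surrogate_utility prior (p k) (U k)"
    if "k \<in> {1..K}" for k
  proof -
    have "surrogate_utility prior (p k) (U k) = (\<Sum>a\<in>UNIV. \<Sum>y\<in>Y. pmf (\<eta> k y) a * ?v k y a)"
      unfolding surrogate_utility_eq NIAS_Max[OF NIAS that] pay[OF that] ..
    also have "\<dots> = (\<Sum>y\<in>Y. MAX a. ?v k y a)"
      by (subst sum.swap) (intro sum.cong refl opt that)
    finally show ?thesis
      by (simp add: expected_utility_eq fin)
  qed
  \<comment> \<open>The policy \<open>p j\<close> is the garbling of \<open>\<alpha> j\<close> by
    \<open>\<eta> j\<close>, so it is worth no more under any utility, in particular under that of
    \<open>k\<close>.\<close>
  have value_ge: "surrogate_utility prior (p j) (U k) \<le> expected_utility prior Y (\<alpha> j) (U k)"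
    if "j \<in> {1..K}" for j k
    unfolding expected_utility_UNIV[symmetric]
    by (rule expected_utility_garble[where Q = "\<eta> j"]) (auto simp: fin match[OF that])
  show "afriat_inequalities prior K p U lam (\<lambda>k. C (\<alpha> k) + 1)"
    unfolding afriat_inequalities_iff[OF NIAS]
  proof (intro ballI)
    fix k j
    assume kj: "k \<in> {1..K}" "j \<in> {1..K}"
    have "\<alpha> j \<in> attention_strategies Y"
      using rat kj by (simp add: rationalizes_with_def is_arg_max_def)
    then have "lam k * expected_utility prior Y (\<alpha> j) (U k) - C (\<alpha> j)
        \<le> lam k * surrogate_utility prior (p k) (U k) - C (\<alpha> k)"
      using rat kj by (auto simp: rationalizes_with_def is_arg_max_def not_less simp flip: value_eq)
    moreover have "lam k * surrogate_utility prior (p j) (U k)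
        \<le> lam k * expected_utility prior Y (\<alpha> j) (U k)"
      using rat kj value_ge by (intro mult_left_mono) (auto simp: rationalizes_with_def less_imp_le)
    ultimately show "lam k * (surrogate_utility prior (p j) (U k) - surrogate_utility prior (p k) (U k))
        \<le> C (\<alpha> j) + 1 - (C (\<alpha> k) + 1)"
      by (simp add: right_diff_distrib)
  qed
qed

lemma afriat_imp_GARRI:
  fixes p :: "nat \<Rightarrow> 'x::finite \<Rightarrow> 'a::finite pmf"
  assumes NIAS: "NIAS prior K p U" and pos: "\<forall>k\<in>{1..K}. 0 < lam k"
    and af: "afriat_inequalities prior K p U lam c"
  shows "GARRI prior K p U"
  unfolding GARRI_def
proof (intro ballI impI)
  fix k j
  let ?G = "\<lambda>i j. surrogate_utility prior (p j) (U i)"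
  assume kj: "k \<in> {1..K}" "j \<in> {1..K}" and "revealed_geq prior K p U k j"
  then obtain idx where idx: "set idx \<subseteq> {1..K}"
      "successively (\<lambda>i i'. ?G i i' \<ge> ?G i i) (k # idx @ [j])"
    by (auto simp: revealed_geq_def)
  have ineq: "lam i * (?G i i' - ?G i i) \<le> c i' - c i" if "i \<in> {1..K}" "i' \<in> {1..K}" for i i'
    using af that by (simp add: afriat_inequalities_iff[OF NIAS])
  have "c i \<le> c i'" if "i \<in> {1..K}" "i' \<in> {1..K}" "?G i i' \<ge> ?G i i" for i i'
  proof -
    have "0 \<le> lam i * (?G i i' - ?G i i)"
      using that pos by (intro mult_nonneg_nonneg) (auto intro: less_imp_le)
    then show ?thesis
      using ineq[OF that(1,2)] by simp
  qed
  then have "c k \<le> c j"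
    using successively_imp_le[OF idx(2) kj(1) idx(1) kj(2), of c] by blast
  \<comment> \<open>The inequality for \<open>j\<close> facing the policy of \<open>k\<close> bounds
    this by \<open>c k - c j\<close>, which the chain makes nonpositive.\<close>
  then have "lam j * (?G j k - ?G j j) \<le> 0"
    using ineq[OF kj(2,1)] by simp
  then show "?G j k \<le> ?G j j"
    using bspec[OF pos kj(2)] by (simp add: mult_le_0_iff)
qed

lemma GARRI_imp_afriat:
  fixes p :: "nat \<Rightarrow> 'x::finite \<Rightarrow> 'a::finite pmf"
  assumes NIAS: "NIAS prior K p U" and GARRI: "GARRI prior K p U"
  shows "\<exists>lam c. (\<forall>k\<in>{1..K}. 0 < lam k \<and> 0 < c k) \<and> afriat_inequalities prior K p U lam c"
proof -
  let ?G = "\<lambda>i j. surrogate_utility prior (p j) (U i)"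
  have "?G j k - ?G j j \<le> 0"
    if "k \<in> {1..K}" "j \<in> {1..K}"
      "(k, j) \<in> {(i, j). i \<in> {1..K} \<and> j \<in> {1..K} \<and> 0 \<le> ?G i j - ?G i i}\<^sup>*" for k j
  \<comment> \<open>GARRI concerns distinct indices; diagonal entries of the matrix are 0.\<close>
  proof (cases "k = j")
    case False
    have "revealed_geq prior K p U k j"
      using rtrancl_imp_successively[OF that(3,1)] by (simp add: revealed_geq_def)
    then show ?thesis
      using GARRI that False by (auto simp: GARRI_def)
  qed simp
  then obtain lam c where
    "\<forall>k\<in>{1..K}. 0 < lam k \<and> 0 < c k \<and> (\<forall>j\<in>{1..K}. lam k * (?G k j - ?G k k) \<le> c j - c k)"
    using afriat[of "{1..K}" "\<lambda>i j. ?G i j - ?G i i"] by blast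
  then show ?thesis
    unfolding afriat_inequalities_iff[OF NIAS] by blast
qed

text \<open>Signal \<open>f a\<close> recommends action \<open>a\<close>, and \<open>inv f\<close>
  decodes it. The cost stays abstract: it suffices that it lies above every piece and is at most
  \<open>c k\<close> at the encoded policy \<open>p k\<close>. Both the truncated cost on
  natural-number signals and the reconstructed cost are instances.\<close>

lemma afriat_imp_rationalizes:
  fixes p :: "nat \<Rightarrow> 'x::finite \<Rightarrow> 'a::finite pmf" and f :: "'a \<Rightarrow> 'y"
  assumes inj: "inj f" and NIAS: "NIAS prior K p U" and pos: "\<forall>k\<in>{1..K}. 0 < lam k"
    and below: "\<And>k \<beta>. k \<in> {1..K} \<Longrightarrow> c k + lam k *
      (expected_utility prior (range f) \<beta> (U k) - surrogate_utility prior (p k) (U k)) \<le> C \<beta>"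
    and tight: "\<And>k. k \<in> {1..K} \<Longrightarrow> C (\<lambda>x. map_pmf f (p k x)) \<le> c k"
  shows "rationalizes_with prior K p U (range f) C lam
    (\<lambda>k x. map_pmf f (p k x)) (\<lambda>k y. return_pmf (inv f y))"
  unfolding rationalizes_with_def
proof (intro conjI ballI impI)
  show "matches_data K p (range f) (\<lambda>k x. map_pmf f (p k x)) (\<lambda>k y. return_pmf (inv f y))"
    unfolding matches_data_def sum.reindex[OF inj]
    by (simp add: inj pmf_map_inj' pmf_return indicator_def if_distrib[of "\<lambda>t. t * _"] cong: if_cong)
next
  fix k y
  assume k: "k \<in> {1..K}" and "y \<in> range f"
    and sig: "0 < signal_prob prior (\<lambda>x. map_pmf f (p k x)) y"
  then obtain a where y: "y = f a"
    by blast
  have "joint_payoff prior (\<lambda>x. map_pmf f (p k x)) (U k) y b = joint_payoff prior (p k) (U k) a b"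
    for b
    by (simp add: joint_payoff_def y pmf_map_inj'[OF inj])
  then show "is_arg_max
      (\<lambda>q. \<Sum>x\<in>UNIV. posterior prior (\<lambda>x. map_pmf f (p k x)) y x * (\<Sum>a\<in>UNIV. pmf q a * U k x a))
      (\<lambda>q. True) (return_pmf (inv f y))"
    using sig inj
    by (simp add: optimal_action_iff NIAS_Max[OF NIAS k] y pmf_return indicator_def
        if_distrib[of "\<lambda>t. t * _"] cong: if_cong)
next
  fix k
  assume k: "k \<in> {1..K}"
  \<comment> \<open>By \<open>below\<close> the left side is at most the optimal value with
    \<open>c k\<close> as cost, and \<open>tight\<close> replaces \<open>c k\<close> by the actual
    cost.\<close>
  have "lam k * expected_utility prior (range f) \<beta> (U k) - C \<beta>
      \<le> lam k * surrogate_utility prior (p k) (U k) - C (\<lambda>x. map_pmf f (p k x))" for \<beta>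
    using below[OF k, of \<beta>] tight[OF k] by (simp add: right_diff_distrib)
  then show "is_arg_max (\<lambda>\<beta>. lam k * expected_utility prior (range f) \<beta> (U k) - C \<beta>)
      (\<lambda>\<beta>. \<beta> \<in> attention_strategies (range f)) (\<lambda>x. map_pmf f (p k x))"
    by (auto simp: is_arg_max_def attention_strategies_def not_less expected_utility_map_inj[OF inj])
qed (use pos in auto)

text \<open>
  The cost of part 4) for a general signal set, truncated at 0: the untruncated one may be negative
  at uninformative strategies.
\<close>

lemma afriat_imp_ex_cost:
  fixes p :: "nat \<Rightarrow> 'x::finite \<Rightarrow> 'a::finite pmf"
  assumes NIAS: "NIAS prior K p U" and pos: "\<forall>k\<in>{1..K}. 0 < lam k \<and> 0 < c k"
    and af: "afriat_inequalities prior K p U lam c"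
  shows "\<exists>(Y :: nat set) C. finite Y \<and> (\<forall>\<alpha>\<in>attention_strategies Y. 0 \<le> C \<alpha>) \<and>
    blackwell_monotone Y C \<and> rationalizes prior K p U Y C"
proof -
  obtain f :: "'a \<Rightarrow> nat" where inj: "inj f"
    using finite_imp_inj_to_nat_seg[of "UNIV :: 'a set"] by auto
  let ?G = "\<lambda>i j. surrogate_utility prior (p j) (U i)"
  let ?piece = "\<lambda>\<beta> k. c k + lam k * (expected_utility prior (range f) \<beta> (U k) - ?G k k)"
  define C where "C \<beta> = Max (insert 0 (?piece \<beta> ` {1..K}))" for \<beta>
  have nonneg: "0 \<le> C \<beta>" for \<beta>
    by (simp add: C_def)
  have below: "?piece \<beta> k \<le> C \<beta>" if "k \<in> {1..K}" for \<beta> k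
    using that unfolding C_def by (intro Max_ge) auto
  \<comment> \<open>At the policy of \<open>k\<close> the Afriat inequalities bound every piece by
    \<open>c k\<close>; positivity of \<open>c k\<close> handles the truncation at 0.\<close>
  have tight: "C (\<lambda>x. map_pmf f (p k x)) \<le> c k" if k: "k \<in> {1..K}" for k
  proof -
    have "c j + lam j * (?G j k - ?G j j) \<le> c k" if "j \<in> {1..K}" for j
    proof -
      have "lam j * (?G j k - ?G j j) \<le> c k - c j"
        using af that k by (simp add: afriat_inequalities_iff[OF NIAS])
      then show ?thesis
        by simp
    qed
    then show ?thesis
      using pos k by (simp add: C_def expected_utility_map_inj[OF inj] less_imp_le)
  qed
  have "blackwell_monotone (range f) C"
    unfolding blackwell_monotone_def
  proof (intro ballI impI)
    fix \<alpha> \<beta> :: "'x \<Rightarrow> nat pmf"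
    assume "blackwell_dominates (range f) \<alpha> \<beta>"
    \<comment> \<open>Garbling lowers each piece because its multiplier is positive, and
      \<open>C \<alpha>\<close> bounds all pieces at \<open>\<alpha>\<close>.\<close>
    then have "?piece \<beta> k \<le> C \<alpha>" if "k \<in> {1..K}" for k
      using that pos
      by (intro order.trans[OF _ below[OF that]] add_left_mono mult_left_mono diff_right_mono
          expected_utility_blackwell) (auto intro: less_imp_le)
    then show "C \<beta> \<le> C \<alpha>"
      using nonneg[of \<alpha>] by (subst C_def) simp
  qed
  moreover have "rationalizes prior K p U (range f) C"
    unfolding rationalizes_def
    using afriat_imp_rationalizes[of f prior K p U lam c C] inj NIAS pos below tight by blast
  ultimately show ?thesis
    using nonneg by (intro exI[of _ "range f"] exI[of _ C]) auto
qed

section \<open>Convexity, Blackwell monotonicity and optimality for the reconstructed cost\<close>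

lemma cost_piece_convex:
  assumes "0 < lam k"
  shows "convex_in_policy (cost_piece prior p U lam c k)"
  unfolding convex_in_policy_def
proof (intro allI ballI)
  fix p' p'' and \<theta> :: real
  let ?G = "\<lambda>q. surrogate_utility prior q (U k)"
  assume "\<theta> \<in> {0..1}"
  then have "lam k * ?G (mix_policy \<theta> p' p'') \<le> lam k * (\<theta> * ?G p' + (1 - \<theta>) * ?G p'')"
    using assms by (intro mult_left_mono surrogate_utility_mix) auto
  then show "cost_piece prior p U lam c k (mix_policy \<theta> p' p'')
      \<le> \<theta> * cost_piece prior p U lam c k p' + (1 - \<theta>) * cost_piece prior p U lam c k p''"
    by (simp add: cost_piece_def algebra_simps)
qed

lemma cost_piece_blackwell:
  assumes "0 < lam k" "blackwell_dominates UNIV q r"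
  shows "cost_piece prior p U lam c k r \<le> cost_piece prior p U lam c k q"
  using assms expected_utility_blackwell[OF finite assms(2), of prior "U k"]
  by (simp add: cost_piece_def expected_utility_UNIV)

lemma reconstructed_cost_le_iff:
  assumes "1 \<le> K"
  shows "reconstructed_cost prior K p U lam c q \<le> t \<longleftrightarrow>
    (\<forall>k\<in>{1..K}. cost_piece prior p U lam c k q \<le> t)"
  using assms by (simp add: reconstructed_cost_def)

lemma cost_piece_le_reconstructed_cost:
  assumes "k \<in> {1..K}"
  shows "cost_piece prior p U lam c k q \<le> reconstructed_cost prior K p U lam c q"
  using assms unfolding reconstructed_cost_def by (intro Max_ge) auto

text \<open>The identity embedding makes each action its own signal, so the attention strategies are
  the policies themselves and \<open>return_pmf\<close> follows the recommendation.\<close>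

lemma reconstructed_cost_rationalizes:
  fixes p :: "nat \<Rightarrow> 'x::finite \<Rightarrow> 'a::finite pmf"
  assumes K: "1 \<le> K" and NIAS: "NIAS prior K p U" and pos: "\<forall>k\<in>{1..K}. 0 < lam k"
    and af: "afriat_inequalities prior K p U lam c"
  shows "rationalizes_with prior K p U UNIV (reconstructed_cost prior K p U lam c) lam p
    (\<lambda>k. return_pmf)"
proof -
  let ?C = "reconstructed_cost prior K p U lam c"
  have "?C (p k) \<le> c k" if k: "k \<in> {1..K}" for k
    unfolding reconstructed_cost_le_iff[OF K]
  proof
    fix j
    assume "j \<in> {1..K}"
    then have "lam j * (surrogate_utility prior (p k) (U j) - surrogate_utility prior (p j) (U j))
        \<le> c k - c j"
      using af k by (simp add: afriat_inequalities_iff[OF NIAS])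
    then show "cost_piece prior p U lam c j (p k) \<le> c k"
      by (simp add: cost_piece_def)
  qed
  moreover have "c k + lam k *
      (expected_utility prior UNIV q (U k) - surrogate_utility prior (p k) (U k)) \<le> ?C q"
    if "k \<in> {1..K}" for k q
    using cost_piece_le_reconstructed_cost[OF that, of prior p U lam c q]
    by (simp add: cost_piece_def expected_utility_UNIV)
  ultimately show ?thesis
    using afriat_imp_rationalizes[of "\<lambda>a. a" prior K p U lam c ?C] NIAS pos
    by (simp add: inv_def[of "\<lambda>a. a"])
qed

lemma reconstructed_cost_blackwell:
  assumes "1 \<le> K" "\<forall>k\<in>{1..K}. 0 < lam k" "blackwell_dominates UNIV q r"
  shows "reconstructed_cost prior K p U lam c r \<le> reconstructed_cost prior K p U lam c q"
  unfolding reconstructed_cost_le_iff[OF assms(1)]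
  using assms by (blast intro: order.trans[OF cost_piece_blackwell cost_piece_le_reconstructed_cost])

lemma reconstructed_cost_mix:
  assumes K: "1 \<le> K" and pos: "\<forall>k\<in>{1..K}. 0 < lam k" and \<theta>: "\<theta> \<in> {0..1}"
  shows "reconstructed_cost prior K p U lam c (mix_policy \<theta> p' p'')
    \<le> \<theta> * reconstructed_cost prior K p U lam c p' + (1 - \<theta>) * reconstructed_cost prior K p U lam c p''"
  unfolding reconstructed_cost_le_iff[OF K]
proof
  fix k
  let ?P = "cost_piece prior p U lam c k" and ?C = "reconstructed_cost prior K p U lam c"
  assume k: "k \<in> {1..K}"
  have "?P (mix_policy \<theta> p' p'') \<le> \<theta> * ?P p' + (1 - \<theta>) * ?P p''"
    using cost_piece_convex[of lam k prior p U c] pos k \<theta> by (simp add: convex_in_policy_def)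
  \<comment> \<open>The bound no longer depends on \<open>k\<close>, so it passes to the maximum
    over the pieces.\<close>
  also have "\<dots> \<le> \<theta> * ?C p' + (1 - \<theta>) * ?C p''"
    using \<theta> by (intro add_mono mult_left_mono cost_piece_le_reconstructed_cost[OF k]) auto
  finally show "?P (mix_policy \<theta> p' p'') \<le> \<theta> * ?C p' + (1 - \<theta>) * ?C p''" .
qed

section \<open>Assembly of the equivalences and of the properties of the reconstructed cost\<close>

theorem corollary1:
  fixes prior :: "'x::finite pmf"
    and K :: nat
    and p :: "nat \<Rightarrow> 'x \<Rightarrow> 'a::finite pmf"
    and U :: "nat \<Rightarrow> 'x \<Rightarrow> 'a \<Rightarrow> real"
  assumes "1 \<le> K"
  shows
    "((\<exists>(Y :: nat set) C. finite Y \<and>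
         (\<forall>\<alpha>\<in>attention_strategies Y. 0 \<le> C \<alpha>) \<and>
         blackwell_monotone Y C \<and> rationalizes prior K p U Y C)
      \<longleftrightarrow> data_matching K p \<and> NIAS prior K p U \<and> GARRI prior K p U)
   \<and> (data_matching K p \<and> NIAS prior K p U \<and> GARRI prior K p U
      \<longleftrightarrow> data_matching K p \<and> NIAS prior K p U \<and>
        (\<exists>lam c. (\<forall>k\<in>{1..K}. 0 < lam k \<and> 0 < c k) \<and> afriat_inequalities prior K p U lam c))
   \<and> (NIAS prior K p U \<and> GARRI prior K p U \<longrightarrow>
        (\<forall>lam c. (\<forall>k\<in>{1..K}. 0 < lam k \<and> 0 < c k) \<and> afriat_inequalities prior K p U lam c \<longrightarrow>
           (let C = reconstructed_cost prior K p U lam c in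
              (\<exists>\<eta>. rationalizes_with prior K p U UNIV C lam p \<eta>) \<and>
              (\<forall>k\<in>{1..K}. convex_in_policy (cost_piece prior p U lam c k) \<and>
                 blackwell_monotone UNIV (cost_piece prior p U lam c k)) \<and>
              (\<forall>q. C q = (MAX k\<in>{1..K}. cost_piece prior p U lam c k q)) \<and>
              (\<forall>q r. blackwell_dominates UNIV q r \<longrightarrow> C r \<le> C q) \<and>
              (\<forall>p' p''. \<forall>\<theta>\<in>{0..1}.
                 C (mix_policy \<theta> p' p'') \<le> \<theta> * C p' + (1 - \<theta>) * C p''))))"
proof -
  define rationalizable where "rationalizable \<longleftrightarrow> (\<exists>(Y :: nat set) C. finite Y \<and>
    (\<forall>\<alpha>\<in>attention_strategies Y. 0 \<le> C \<alpha>) \<and> blackwell_monotone Y C \<and> rationalizes prior K p U Y C)"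
  define solvable where "solvable \<longleftrightarrow>
    (\<exists>lam c. (\<forall>k\<in>{1..K}. 0 < lam k \<and> 0 < c k) \<and> afriat_inequalities prior K p U lam c)"
  have "data_matching K p \<and> NIAS prior K p U \<and> solvable" if rationalizable
  proof -
    from that obtain Y :: "nat set" and C lam \<alpha> \<eta>
      where fin: "finite Y" and nonneg: "\<forall>\<alpha>\<in>attention_strategies Y. 0 \<le> C \<alpha>"
        and rat: "rationalizes_with prior K p U Y C lam \<alpha> \<eta>"
      by (auto simp: rationalizable_def rationalizes_def)
    have strat: "\<forall>k\<in>{1..K}. \<alpha> k \<in> attention_strategies Y"
      using rat by (simp add: rationalizes_with_def is_arg_max_def)
    then have "data_matching K p"
      using rat fin by (auto simp: data_matching_def rationalizes_with_def)
    moreover have "\<forall>k\<in>{1..K}. 0 < lam k \<and> 0 < C (\<alpha> k) + 1"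
      using rat strat nonneg by (auto simp: rationalizes_with_def add_nonneg_pos)
    then have solvable
      unfolding solvable_def using rationalizes_imp_afriat(2)[OF fin rat]
      by (intro exI[of _ lam] exI[of _ "\<lambda>k. C (\<alpha> k) + 1"] conjI)
    ultimately show ?thesis
      using rationalizes_imp_afriat(1)[OF fin rat] by simp
  qed
  \<comment> \<open>A solution of the inequalities yields both GARRI and a rationalizing cost; with
    the reverse implication from GARRI, all three statements are linked.\<close>
  moreover have "GARRI prior K p U" "rationalizable" if "NIAS prior K p U" solvable
    using that afriat_imp_GARRI afriat_imp_ex_cost[OF that(1)]
    unfolding solvable_def rationalizable_def by metis+
  moreover have solvable if "NIAS prior K p U" "GARRI prior K p U"
    unfolding solvable_def by (rule GARRI_imp_afriat[OF that])
  ultimately have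
    "rationalizable \<longleftrightarrow> data_matching K p \<and> NIAS prior K p U \<and> GARRI prior K p U"
    "data_matching K p \<and> NIAS prior K p U \<and> GARRI prior K p U \<longleftrightarrow>
      data_matching K p \<and> NIAS prior K p U \<and> solvable"
    by blast+
  note equivalences = this[unfolded rationalizable_def solvable_def]
  have properties: "let C = reconstructed_cost prior K p U lam c in
      (\<exists>\<eta>. rationalizes_with prior K p U UNIV C lam p \<eta>) \<and>
      (\<forall>k\<in>{1..K}. convex_in_policy (cost_piece prior p U lam c k) \<and>
         blackwell_monotone UNIV (cost_piece prior p U lam c k)) \<and>
      (\<forall>q. C q = (MAX k\<in>{1..K}. cost_piece prior p U lam c k q)) \<and>
      (\<forall>q r. blackwell_dominates UNIV q r \<longrightarrow> C r \<le> C q) \<and>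
      (\<forall>p' p''. \<forall>\<theta>\<in>{0..1}. C (mix_policy \<theta> p' p'') \<le> \<theta> * C p' + (1 - \<theta>) * C p'')"
    if NIAS: "NIAS prior K p U" and sol: "\<forall>k\<in>{1..K}. 0 < lam k \<and> 0 < c k"
      and af: "afriat_inequalities prior K p U lam c" for lam c
  proof -
    have pos: "\<forall>k\<in>{1..K}. 0 < lam k"
      using sol by blast
    have "blackwell_monotone UNIV (cost_piece prior p U lam c k)" if "k \<in> {1..K}" for k
      using bspec[OF pos that] by (simp add: blackwell_monotone_def cost_piece_blackwell)
    with pos show ?thesis
      unfolding Let_def
      by (intro conjI exI[of _ "\<lambda>k. return_pmf"] allI impI ballI
          reconstructed_cost_rationalizes[OF assms NIAS pos af]
          cost_piece_convex reconstructed_cost_blackwell[OF assms pos]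
          reconstructed_cost_mix[OF assms pos]) (simp_all add: reconstructed_cost_def)
  qed
  show ?thesis
    by (intro conjI[OF equivalences(1)] conjI[OF equivalences(2)] impI allI)
      (elim conjE, rule properties)
qed

end
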